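(* In social Hegselmann-Krause dynamics on $n$ agents, all the link breaks and intra-component link formations always occur in $O(n^8\log n)$ time steps. Hence, if there exists $\epsilon>0$ such that $k_\epsilon^*(G_{ph})=\infty$, then there exists a nonempty set $\mathcal X_0\subset\mathbb{R}^n$ such that whenever $x[0]\in\mathcal X_0$, merging occurs at least once during the process of opinion evolution.
   Context: Social Hegselmann-Krause (HK) dynamics: there are $n$ agents, with $[n]=\{1,\dots,n\}$, and a fixed confidence bound $R>0$. The physical connectivity graph $G_{ph}=([n],E_{ph})$ is an undirected, time-invariant, connected graph containing all self-loops. The state at time $k=0,1,2,\dots$ is $x[k]\in\mathbb{R}^n$. The influence graph $\tilde G[k]$ has vertex set $[n]$ and has the edge $(i,j)$ iff $(i,j)\in E_{ph}$ and $|x_i[k]-x_j[k]|\le R$. The update rule is $x_i[k+1]=\frac{1}{|\mathcal N_i[k]|}\sum_{j\in\mathcal N_i[k]}x_j[k]$, where $\mathcal N_i[k]$ is the set of neighbors of $i$ in $\tilde G[k]$ (including $i$ itself). For every initial state $x[0]=x_0$ the limit (steady state) $x_\infty(x_0):=\lim_{k\to\infty}x[k]$ exists. For $\epsilon>0$, $k_\epsilon(G_{ph},x_0):=\inf\{N\in\mathbb{N}:\|x[k]-x_\infty(x_0)\|<\epsilon\text{ for all }k\ge N\}$ (Euclidean norm), and $k_\epsilon^*(G_{ph}):=\sup_{x_0\in\mathbb{R}^n}k_\epsilon(G_{ph},x_0)$. Events. A link break between $i$ and $j$ occurs at time $k\ge1$ if $i,j$ are adjacent in $\tilde G[k-1]$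 but non-adjacent in $\tilde G[k]$. Merging: if $\tilde G[k_0-1]$ is a disconnected graph ($k_0\ge1$) and $G_1,G_2$ are the subgraphs of $\tilde G$ induced by vertex sets $V_1,V_2$ that are disconnected from each other in $\tilde G[k_0-1]$, then $G_1$ and $G_2$ merge at time $k_0$ if some $i\in V_1$ and $j\in V_2$ become neighbors at time $k_0$, i.e., are adjacent in $\tilde G[k_0]$. An intra-component link formation is the formation of a link (non-adjacent at time $k-1$, adjacent at time $k$) between two agents belonging to the same connected component of the influence graph. The $O(\cdot)$ notation is with respect to $n$; the implied constant does not depend on $G_{ph}$ or $x[0]$.
   Formalization: Events can occur arbitrarily late after a slow merging, so a deadline from time 0 fails. Formalized: the number of time steps with such events is O(n^8 log n), and any such event not preceded by a merging occurs by time O(n^8 log n). *)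

theory Defs
  imports "HOL-Analysis.Analysis" "HOL-Library.FuncSet" "HOL-Library.Landau_Symbols"
    "HOL-Library.Extended_Nat"
begin

text \<open>
  The number of agents \<open>n\<close> is quantified inside the statement, so \<open>\<real>\<^sup>n\<close> cannot be a type
  here: it is the set of extensional functions on \<open>{1..n}\<close>. Graphs are given by a vertex set and
  a symmetric edge relation; self-loops are allowed.
\<close>

definition state_space :: "nat \<Rightarrow> (nat \<Rightarrow> real) set" where
  "state_space n = ({1..n} \<rightarrow>\<^sub>E UNIV)"

definition graph_connected :: "'a set \<Rightarrow> ('a \<times> 'a) set \<Rightarrow> bool" where
  "graph_connected V E \<longleftrightarrow> V \<noteq> {} \<and> (\<forall>u\<in>V. \<forall>v\<in>V. (u, v) \<in> E\<^sup>*)"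

definition physical_graph :: "nat \<Rightarrow> (nat \<times> nat) set \<Rightarrow> bool" where
  "physical_graph n E \<longleftrightarrow>
     E \<subseteq> {1..n} \<times> {1..n} \<and> refl_on {1..n} E \<and> sym E \<and> graph_connected {1..n} E"

definition influence_edges :: "real \<Rightarrow> (nat \<times> nat) set \<Rightarrow> (nat \<Rightarrow> real) \<Rightarrow> (nat \<times> nat) set" where
  "influence_edges R E x = {(i, j) \<in> E. \<bar>x i - x j\<bar> \<le> R}"

definition hk_nbrs :: "real \<Rightarrow> (nat \<times> nat) set \<Rightarrow> (nat \<Rightarrow> real) \<Rightarrow> nat \<Rightarrow> nat set" where
  "hk_nbrs R E x i = {j. (i, j) \<in> influence_edges R E x}"

definition hk_step :: "nat \<Rightarrow> real \<Rightarrow> (nat \<times> nat) set \<Rightarrow> (nat \<Rightarrow> real) \<Rightarrow> (nat \<Rightarrow> real)" where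
  "hk_step n R E x =
     (\<lambda>i\<in>{1..n}. (\<Sum>j\<in>hk_nbrs R E x i. x j) / real (card (hk_nbrs R E x i)))"

definition hk_traj :: "nat \<Rightarrow> real \<Rightarrow> (nat \<times> nat) set \<Rightarrow> (nat \<Rightarrow> real) \<Rightarrow> nat \<Rightarrow> (nat \<Rightarrow> real)" where
  "hk_traj n R E x0 k = (hk_step n R E ^^ k) x0"

definition influence_graph ::
    "nat \<Rightarrow> real \<Rightarrow> (nat \<times> nat) set \<Rightarrow> (nat \<Rightarrow> real) \<Rightarrow> nat \<Rightarrow> (nat \<times> nat) set" where
  "influence_graph n R E x0 k = influence_edges R E (hk_traj n R E x0 k)"

text \<open>The limit in \<open>\<real>\<^sup>n\<close> is taken coordinatewise.\<close>

definition steady_state :: "nat \<Rightarrow> real \<Rightarrow> (nat \<times> nat) set \<Rightarrow> (nat \<Rightarrow> real) \<Rightarrow> (nat \<Rightarrow> real)" where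
  "steady_state n R E x0 = (\<lambda>i\<in>{1..n}. lim (\<lambda>k. hk_traj n R E x0 k i))"

definition conv_time :: "nat \<Rightarrow> real \<Rightarrow> (nat \<times> nat) set \<Rightarrow> real \<Rightarrow> (nat \<Rightarrow> real) \<Rightarrow> enat" where
  "conv_time n R E \<epsilon> x0 =
     (INF N\<in>{N. \<forall>k\<ge>N. L2_set (\<lambda>i. hk_traj n R E x0 k i - steady_state n R E x0 i) {1..n} < \<epsilon>}.
        enat N)"

definition max_conv_time :: "nat \<Rightarrow> real \<Rightarrow> (nat \<times> nat) set \<Rightarrow> real \<Rightarrow> enat" where
  "max_conv_time n R E \<epsilon> = (SUP x0\<in>state_space n. conv_time n R E \<epsilon> x0)"

text \<open>
  In the following, \<open>G k\<close> is the edge relation at time \<open>k\<close> of a time-varying graph.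
\<close>

definition link_break_at :: "(nat \<Rightarrow> ('a \<times> 'a) set) \<Rightarrow> nat \<Rightarrow> bool" where
  "link_break_at G k \<longleftrightarrow> k \<ge> 1 \<and> (\<exists>i j. (i, j) \<in> G (k - 1) \<and> (i, j) \<notin> G k)"

text \<open>
  The common component is that of time \<open>k - 1\<close>: at time \<open>k\<close> the two agents always share a
  component, because of the newly formed link.
\<close>

definition intra_component_formation_at :: "(nat \<Rightarrow> ('a \<times> 'a) set) \<Rightarrow> nat \<Rightarrow> bool" where
  "intra_component_formation_at G k \<longleftrightarrow>
     k \<ge> 1 \<and> (\<exists>i j. (i, j) \<notin> G (k - 1) \<and> (i, j) \<in> G k \<and> (i, j) \<in> (G (k - 1))\<^sup>*)"

definition merging_at :: "'a set \<Rightarrow> (nat \<Rightarrow> ('a \<times> 'a) set) \<Rightarrow> nat \<Rightarrow> bool" where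
  "merging_at V G k \<longleftrightarrow>
     k \<ge> 1 \<and> \<not> graph_connected V (G (k - 1)) \<and>
     (\<exists>V1 V2. V1 \<subseteq> V \<and> V2 \<subseteq> V \<and> (\<forall>u\<in>V1. \<forall>v\<in>V2. (u, v) \<notin> (G (k - 1))\<^sup>*) \<and>
        (\<exists>i\<in>V1. \<exists>j\<in>V2. (i, j) \<in> G k))"

definition event_times :: "(nat \<Rightarrow> ('a \<times> 'a) set) \<Rightarrow> nat set" where
  "event_times G = {k. link_break_at G k \<or> intra_component_formation_at G k}"

text \<open>
  All link breaks and intra-component link formations occur in at most \<open>t\<close> time steps: there are
  at most \<open>t\<close> time steps with such an event, and as long as no merging has occurred, these are
  among the first \<open>t\<close> time steps. (A bound on the absolute time of the last event cannot hold in
  general: a merging can occur arbitrarily late, and an intra-component link formation can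
  follow it.)
\<close>

definition events_occur_in :: "'a set \<Rightarrow> (nat \<Rightarrow> ('a \<times> 'a) set) \<Rightarrow> real \<Rightarrow> bool" where
  "events_occur_in V G t \<longleftrightarrow>
     finite (event_times G) \<and> real (card (event_times G)) \<le> t \<and>
     (\<forall>k\<in>event_times G. (\<forall>m<k. \<not> merging_at V G m) \<longrightarrow> real k \<le> t)"

end

theory Submission
  imports Defs "HOL-Real_Asymp.Real_Asymp"
begin

text \<open>
  Call a state wide at scale \<open>d\<close> if some two agents in one component of its influence graph are
  more than \<open>d\<close> apart. Three facts about this notion give the theorem.

  \<^item> Wide states are rare (\<open>few_wide_times\<close>): the energy, i.e. the sum of
    \<open>min R\<^sup>2 (x\<^sub>i - x\<^sub>j)\<^sup>2\<close> over all physical links, starts at no more than \<open>n\<^sup>2 R\<^sup>2\<close> and never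
    increases. A component of diameter more than \<open>d\<close> has a gap of length \<open>d / n\<close> that some link
    bridges. The resulting pull across the gap displaces the agents so much that the energy drops
    by at least \<open>4 d\<^sup>2 / n\<^sup>5\<close>. So at most \<open>n\<^sup>7 R\<^sup>2 / (4 d\<^sup>2)\<close> times are wide.

  \<^item> Events need width (\<open>event_imp_wide\<close>): every agent moves into the convex hull of its component.
    If no component is wider than \<open>R\<close>, then no link inside a component can break, and every
    physical link inside a component is already present.

  \<^item> Narrowness persists without merging (\<open>narrow_persists\<close>): if all new links lie inside old
    components, then components can only shrink, and so can their diameters.

  The first two facts at scale \<open>R\<close> bound the number of event times by \<open>n\<^sup>7\<close>. By the third one, the
  wide times before the first merging form an initial segment, so the same number bounds the
  absolute time of every event that precedes all mergings.

  If merging never occurred, then for every scale \<open>d\<close> the whole wide set would be an initial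
  segment whose length is bounded independently of the initial state. After it each agent stays
  within \<open>d\<close> of where it is, which makes the convergence time bounded for every \<open>\<epsilon>\<close>.
\<close>

section \<open>One step of the dynamics\<close>

lemma physical_graphD:
  assumes "physical_graph n E"
  shows "E \<subseteq> {1..n} \<times> {1..n}" "finite E" "sym E" "\<And>i. i \<in> {1..n} \<Longrightarrow> (i, i) \<in> E" "n \<ge> 1"
  using assms finite_subset[of E "{1..n} \<times> {1..n}"]
  by (auto simp: physical_graph_def refl_on_def graph_connected_def)

lemma influence_edges_basic:
  assumes "physical_graph n E" "R > 0"
  shows "influence_edges R E x \<subseteq> {1..n} \<times> {1..n}" "finite (influence_edges R E x)"
    "sym (influence_edges R E x)" "\<And>i. i \<in> {1..n} \<Longrightarrow> (i, i) \<in> influence_edges R E x"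
proof -
  note P = physical_graphD[OF assms(1)]
  show "influence_edges R E x \<subseteq> {1..n} \<times> {1..n}"
    using P(1) by (auto simp: influence_edges_def)
  then show "finite (influence_edges R E x)"
    by (rule finite_subset) auto
  show "sym (influence_edges R E x)"
    using P(3) by (auto simp: influence_edges_def sym_def abs_minus_commute)
  show "(i, i) \<in> influence_edges R E x" if "i \<in> {1..n}" for i
    using P(4)[OF that] assms(2) by (auto simp: influence_edges_def)
qed

lemma hk_nbrs_basic:
  assumes "physical_graph n E" "R > 0"
  shows "hk_nbrs R E x i \<subseteq> {1..n}" "finite (hk_nbrs R E x i)" "card (hk_nbrs R E x i) \<le> n"
    "i \<in> {1..n} \<Longrightarrow> i \<in> hk_nbrs R E x i" "i \<in> {1..n} \<Longrightarrow> card (hk_nbrs R E x i) > 0"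
proof -
  note I = influence_edges_basic[OF assms]
  show sub: "hk_nbrs R E x i \<subseteq> {1..n}"
    using I(1)[of x] by (auto simp: hk_nbrs_def)
  then show fin: "finite (hk_nbrs R E x i)"
    by (rule finite_subset) auto
  show "card (hk_nbrs R E x i) \<le> n"
    using card_mono[OF _ sub] by simp
  show self: "i \<in> hk_nbrs R E x i" if "i \<in> {1..n}"
    using I(4)[OF that] by (simp add: hk_nbrs_def)
  show "card (hk_nbrs R E x i) > 0" if "i \<in> {1..n}"
    using self[OF that] fin by (auto simp: card_gt_0_iff)
qed

lemma influence_edges_eq_Sigma:
  assumes "physical_graph n E" "R > 0"
  shows "influence_edges R E x = Sigma {1..n} (hk_nbrs R E x)"
  using influence_edges_basic(1)[OF assms, of x] by (auto simp: hk_nbrs_def)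

lemma displacement_eq:
  assumes "physical_graph n E" "R > 0" "i \<in> {1..n}"
  shows "real (card (hk_nbrs R E x i)) * (hk_step n R E x i - x i)
       = (\<Sum>j\<in>hk_nbrs R E x i. x j - x i)"
  using hk_nbrs_basic(5)[OF assms(1,2), of i x] assms(3)
  by (simp add: hk_step_def sum_subtractf algebra_simps)

lemma hk_step_near:
  assumes "physical_graph n E" "R > 0" "i \<in> {1..n}"
    and near: "\<And>j. j \<in> hk_nbrs R E x i \<Longrightarrow> \<bar>x j - c\<bar> \<le> d"
  shows "\<bar>hk_step n R E x i - c\<bar> \<le> d"
proof -
  let ?N = "hk_nbrs R E x i"
  have pos: "real (card ?N) > 0"
    using hk_nbrs_basic(5)[OF assms(1,2)] assms(3) by simp
  have "hk_step n R E x i - c = (\<Sum>j\<in>?N. x j - c) / real (card ?N)"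
    using pos assms(3) by (simp add: hk_step_def sum_subtractf field_simps)
  moreover have "\<bar>\<Sum>j\<in>?N. x j - c\<bar> \<le> real (card ?N) * d"
    using order_trans[OF sum_abs sum_bounded_above[of ?N "\<lambda>j. \<bar>x j - c\<bar>" d]] near by simp
  ultimately show ?thesis
    using pos by (simp add: pos_divide_le_eq mult.commute)
qed

section \<open>Energy\<close>

text \<open>The truncation at \<open>R\<^sup>2\<close> makes link breaks harmless: a missing link already
  contributes the largest possible amount.\<close>

definition energy :: "real \<Rightarrow> (nat \<times> nat) set \<Rightarrow> (nat \<Rightarrow> real) \<Rightarrow> real" where
  "energy R E x = (\<Sum>(i, j)\<in>E. min (R\<^sup>2) ((x i - x j)\<^sup>2))"

lemma energy_nonneg: "energy R E x \<ge> 0"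
  by (auto simp: energy_def intro!: sum_nonneg)

lemma energy_le:
  assumes "physical_graph n E"
  shows "energy R E x \<le> (real n)\<^sup>2 * R\<^sup>2"
proof -
  note P = physical_graphD[OF assms]
  have "energy R E x \<le> real (card E) * R\<^sup>2"
    unfolding energy_def by (intro sum_bounded_above) auto
  moreover have "card E \<le> n * n"
    using card_mono[OF _ P(1)] by (simp add: card_cartesian_product)
  then have "real (card E) \<le> (real n)\<^sup>2"
    by (simp add: power2_eq_square flip: of_nat_mult)
  ultimately show ?thesis
    by (meson order_trans mult_right_mono zero_le_power2)
qed

lemma sum_sym_swap:
  fixes f :: "'a \<Rightarrow> 'a \<Rightarrow> real"
  assumes "sym G"
  shows "(\<Sum>(i, j)\<in>G. f i j) = (\<Sum>(i, j)\<in>G. f j i)"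
  by (rule sum.reindex_bij_witness[of _ prod.swap prod.swap])
    (use assms in \<open>auto simp: sym_def\<close>)

text \<open>
  Averaging is a gradient step for the quadratic form of the graph, so with the displacements
  \<open>y\<close> the form loses exactly the sum of \<open>(y\<^sub>i + y\<^sub>j)\<^sup>2\<close> over all links. The self-loops contribute
  \<open>4 y\<^sub>i\<^sup>2\<close> each. Links absent from the influence graph cannot gain, by truncation.
\<close>

lemma energy_drop:
  fixes n R E x
  assumes "physical_graph n E" "R > 0"
  defines "x' \<equiv> hk_step n R E x"
  shows "energy R E x' + 4 * (\<Sum>i\<in>{1..n}. (x' i - x i)\<^sup>2) \<le> energy R E x"
proof -
  let ?G = "influence_edges R E x"
  define y where "y i = x' i - x i" for i
  define D where "D = (\<Sum>(i, j)\<in>?G. (y i)\<^sup>2)"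
  note I = influence_edges_basic[OF assms(1,2)]
  have Gsum: "(\<Sum>(i, j)\<in>?G. f i j) = (\<Sum>i\<in>{1..n}. \<Sum>j\<in>hk_nbrs R E x i. f i j)"
    for f :: "nat \<Rightarrow> nat \<Rightarrow> real"
    unfolding influence_edges_eq_Sigma[OF assms(1,2)]
    by (rule sum.Sigma[symmetric]) (use hk_nbrs_basic(2)[OF assms(1,2)] in auto)
  have pull: "(\<Sum>(i, j)\<in>?G. y i * (x j - x i)) = D"
    unfolding D_def Gsum
  proof (rule sum.cong)
    fix i assume i: "i \<in> {1..n}"
    show "(\<Sum>j\<in>hk_nbrs R E x i. y i * (x j - x i)) = (\<Sum>j\<in>hk_nbrs R E x i. (y i)\<^sup>2)"
      using displacement_eq[OF assms(1,2) i, of x]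
      by (simp add: y_def x'_def power2_eq_square flip: sum_distrib_left)
  qed simp
  have pull': "(\<Sum>(i, j)\<in>?G. y j * (x i - x j)) = D"
    using pull sum_sym_swap[OF I(3)[of x], of "\<lambda>i j. y i * (x j - x i)"] by simp
  have D': "(\<Sum>(i, j)\<in>?G. (y j)\<^sup>2) = D"
    unfolding D_def using sum_sym_swap[OF I(3)[of x], of "\<lambda>i j. (y i)\<^sup>2"] by simp
  have "(\<Sum>(i, j)\<in>?G. (x i - x j)\<^sup>2) - (\<Sum>(i, j)\<in>?G. (x' i - x' j)\<^sup>2)
      = (\<Sum>(i, j)\<in>?G. (y i + y j)\<^sup>2 + 2 * (y i * (x j - x i)) + 2 * (y j * (x i - x j))
                      - 2 * (y i)\<^sup>2 - 2 * (y j)\<^sup>2)"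
    unfolding sum_subtractf[symmetric] y_def
    by (intro sum.cong) (auto simp: power2_eq_square algebra_simps)
  also have "\<dots> = (\<Sum>(i, j)\<in>?G. (y i + y j)\<^sup>2) + 2 * D + 2 * D - 2 * D - 2 * D"
    unfolding pull[symmetric] pull'[symmetric]
    using D' D_def pull pull'
    by (simp add: sum.distrib sum_subtractf case_prod_unfold flip: sum_distrib_left)
  finally have loss: "(\<Sum>(i, j)\<in>?G. (x i - x j)\<^sup>2) - (\<Sum>(i, j)\<in>?G. (x' i - x' j)\<^sup>2)
      = (\<Sum>(i, j)\<in>?G. (y i + y j)\<^sup>2)"
    by simp
  have "4 * (\<Sum>i\<in>{1..n}. (y i)\<^sup>2) = (\<Sum>(i, j)\<in>(\<lambda>i. (i, i)) ` {1..n}. (y i + y j)\<^sup>2)"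
    by (subst sum.reindex) (auto simp: inj_on_def sum_distrib_left power2_eq_square algebra_simps)
  also have "\<dots> \<le> (\<Sum>(i, j)\<in>?G. (y i + y j)\<^sup>2)"
    by (intro sum_mono2) (use I(2,4) in auto)
  finally have self: "4 * (\<Sum>i\<in>{1..n}. (y i)\<^sup>2) \<le> (\<Sum>(i, j)\<in>?G. (y i + y j)\<^sup>2)" .
  have sub: "?G \<subseteq> E"
    by (auto simp: influence_edges_def)
  note finE = physical_graphD(2)[OF assms(1)]
  have split: "energy R E z = (\<Sum>(i, j)\<in>E - ?G. min (R\<^sup>2) ((z i - z j)\<^sup>2))
      + (\<Sum>(i, j)\<in>?G. min (R\<^sup>2) ((z i - z j)\<^sup>2))" for z
    unfolding energy_def by (rule sum.subset_diff[OF sub finE])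
  have le_R: "(x i - x j)\<^sup>2 \<le> R\<^sup>2 \<longleftrightarrow> \<bar>x i - x j\<bar> \<le> R" for i j
    using assms(2) by (simp add: abs_le_square_iff[symmetric])
  have "(\<Sum>(i, j)\<in>?G. min (R\<^sup>2) ((x i - x j)\<^sup>2)) = (\<Sum>(i, j)\<in>?G. (x i - x j)\<^sup>2)"
    by (intro sum.cong) (auto simp: influence_edges_def le_R min_absorb2)
  moreover have "(\<Sum>(i, j)\<in>?G. min (R\<^sup>2) ((x' i - x' j)\<^sup>2)) \<le> (\<Sum>(i, j)\<in>?G. (x' i - x' j)\<^sup>2)"
    by (intro sum_mono) auto
  moreover have "(\<Sum>(i, j)\<in>E - ?G. min (R\<^sup>2) ((x' i - x' j)\<^sup>2))
      \<le> (\<Sum>(i, j)\<in>E - ?G. min (R\<^sup>2) ((x i - x j)\<^sup>2))"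
  proof (intro sum_mono)
    fix e assume "e \<in> E - ?G"
    then obtain i j where e: "e = (i, j)" "\<not> \<bar>x i - x j\<bar> \<le> R"
      by (auto simp: influence_edges_def)
    then have "\<not> (x i - x j)\<^sup>2 \<le> R\<^sup>2"
      using le_R by blast
    then have "min (R\<^sup>2) ((x i - x j)\<^sup>2) = R\<^sup>2"
      by simp
    then show "(case e of (i, j) \<Rightarrow> min (R\<^sup>2) ((x' i - x' j)\<^sup>2))
        \<le> (case e of (i, j) \<Rightarrow> min (R\<^sup>2) ((x i - x j)\<^sup>2))"
      by (simp add: e)
  qed
  ultimately show ?thesis
    using split[of x] split[of x'] loss self by (simp add: y_def)
qed

section \<open>Wide components\<close>

definition wide :: "real \<Rightarrow> (nat \<times> nat) set \<Rightarrow> (nat \<Rightarrow> real) \<Rightarrow> bool" where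
  "wide d G x \<longleftrightarrow> (\<exists>(i, j)\<in>G\<^sup>*. d < \<bar>x i - x j\<bar>)"

text \<open>The \<open>n\<close> disjoint intervals of length \<open>d / n\<close> above \<open>x q\<close> cannot all
  contain an agent, because \<open>q\<close> itself is in none of them.\<close>

lemma gap_exists:
  fixes x :: "nat \<Rightarrow> real"
  assumes "d > 0" "q \<in> {1..n}" "x q + d < x p"
  obtains a where "x q \<le> a" "a + d / n < x p"
    "\<And>i. i \<in> {1..n} \<Longrightarrow> x i \<le> a \<or> a + d / n < x i"
proof -
  have n: "real n > 0"
    using assms(2) by auto
  define a where "a k = x q + real k * (d / n)" for k :: nat
  have mono: "a k \<le> a l" if "k \<le> l" for k l
    using that assms(1) n by (auto simp: a_def divide_right_mono mult_right_mono)
  have "\<exists>k<n. \<forall>i\<in>{1..n}. x i \<le> a k \<or> a (Suc k) < x i"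
  proof (rule ccontr)
    assume "\<not> ?thesis"
    then have "\<forall>k\<in>{..<n}. \<exists>i\<in>{1..n}. a k < x i \<and> x i \<le> a (Suc k)"
      by (meson lessThan_iff not_le)
    then obtain f where f: "\<And>k. k < n \<Longrightarrow> f k \<in> {1..n} \<and> a k < x (f k) \<and> x (f k) \<le> a (Suc k)"
      by (metis lessThan_iff)
    have "f k \<noteq> f l" if "k < l" "l < n" for k l
      using f[of k] f[of l] mono[of "Suc k" l] that by auto
    then have "inj_on f {..<n}"
      by (metis inj_onI lessThan_iff linorder_neqE_nat)
    moreover have "f k \<in> {1..n} - {q}" if "k < n" for k
      using f[OF that] mono[of 0 k] by (auto simp: a_def[of 0])
    then have "f ` {..<n} \<subseteq> {1..n} - {q}"
      by auto
    ultimately have "n \<le> card ({1..n} - {q})"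
      by (metis card_inj_on_le card_lessThan finite_Diff finite_atLeastAtMost)
    then show False
      using assms(2) by auto
  qed
  then obtain k where k: "k < n" "\<forall>i\<in>{1..n}. x i \<le> a k \<or> a (Suc k) < x i"
    by blast
  have Suc: "a (Suc k) = a k + d / n"
    by (simp add: a_def algebra_simps add_divide_distrib)
  have "a n = x q + d"
    using n by (simp add: a_def)
  then show thesis
    using that[of "a k"] k mono[of 0 k] mono[of "Suc k" n] assms(3)
    by (auto simp: Suc a_def[of 0])
qed

lemma rtrancl_endpoints:
  assumes "(p, q) \<in> G\<^sup>*" "G \<subseteq> A \<times> A"
  shows "p = q \<or> p \<in> A \<and> q \<in> A"
  using assms by (induction rule: rtrancl_induct) auto

text \<open>
  Let \<open>U\<close> be the part of the component above a gap. In the total displacement of \<open>U\<close>, weighted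
  by degrees, the links inside \<open>U\<close> cancel, and every link leaving \<open>U\<close> pulls downwards by more
  than the length of the gap. At least one such link exists, as the component is connected.
\<close>

lemma wide_displacement:
  assumes "physical_graph n E" "R > 0" "d > 0" and w: "wide d (influence_edges R E x) x"
  shows "(\<Sum>i\<in>{1..n}. (hk_step n R E x i - x i)\<^sup>2) \<ge> d\<^sup>2 / real n ^ 5"
proof -
  let ?G = "influence_edges R E x"
  note I = influence_edges_basic[OF assms(1,2)]
  note N = hk_nbrs_basic[OF assms(1,2)]
  define y where "y i = hk_step n R E x i - x i" for i
  obtain u v where uv: "(u, v) \<in> ?G\<^sup>*" "d < \<bar>x u - x v\<bar>"
    using w by (auto simp: wide_def)
  have "(v, u) \<in> ?G\<^sup>*"
    using uv(1) sym_rtrancl[OF I(3)] by (meson symD)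
  moreover have "x v + d < x u \<or> x u + d < x v"
    using uv(2) by linarith
  ultimately obtain p q where pq: "(p, q) \<in> ?G\<^sup>*" "x q + d < x p"
    using uv(1) by blast
  have "p \<noteq> q"
    using pq(2) assms(3) by auto
  then have V: "p \<in> {1..n}" "q \<in> {1..n}"
    using rtrancl_endpoints[OF pq(1) I(1)] by auto
  then have n: "real n > 0"
    by auto
  then have gap_pos: "d / n > 0"
    using assms(3) by simp
  obtain a where a: "x q \<le> a" "a + d / n < x p"
    "\<And>i. i \<in> {1..n} \<Longrightarrow> x i \<le> a \<or> a + d / n < x i"
    using gap_exists[OF assms(3) V(2) pq(2)] by blast
  define U where "U = {i\<in>{1..n}. a < x i}"
  have finU: "finite U"
    by (simp add: U_def)
  have "p \<in> U" "q \<notin> U"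
    using a(1,2) V(1) gap_pos by (auto simp: U_def)
  have "\<exists>s t. (s, t) \<in> ?G \<and> s \<in> U \<and> t \<notin> U"
  proof (rule ccontr)
    assume closed: "\<not> ?thesis"
    have "t \<in> U" if "(p, t) \<in> ?G\<^sup>*" for t
      using that by (induction rule: rtrancl_induct) (use \<open>p \<in> U\<close> closed in blast)+
    then show False
      using pq(1) \<open>q \<notin> U\<close> by blast
  qed
  then obtain s t where st: "(s, t) \<in> ?G" "s \<in> U" "t \<notin> U"
    by blast
  define C where "C = {(i, j)\<in>?G. i \<in> U \<and> j \<notin> U}"
  define B where "B = {(i, j)\<in>?G. i \<in> U \<and> j \<in> U}"
  have fin: "finite C" "finite B"
    by (auto intro: finite_subset[OF _ I(2)[of x]] simp: C_def B_def)
  have "sym B"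
    using I(3)[of x] by (auto simp: B_def sym_def)
  have inner: "(\<Sum>(i, j)\<in>B. x j - x i) = 0"
    using sum_sym_swap[OF \<open>sym B\<close>, of "\<lambda>i j. x j - x i"]
    by (simp add: sum_subtractf case_prod_unfold)
  have "(\<Sum>i\<in>U. real (card (hk_nbrs R E x i)) * y i)
      = (\<Sum>i\<in>U. \<Sum>j\<in>hk_nbrs R E x i. x j - x i)"
    using displacement_eq[OF assms(1,2)] by (intro sum.cong) (auto simp: y_def U_def)
  also have "\<dots> = (\<Sum>(i, j)\<in>Sigma U (hk_nbrs R E x). x j - x i)"
    by (rule sum.Sigma) (use finU N(2) in auto)
  also have "Sigma U (hk_nbrs R E x) = B \<union> C"
    by (auto simp: B_def C_def hk_nbrs_def)
  also have "(\<Sum>(i, j)\<in>B \<union> C. x j - x i) = (\<Sum>(i, j)\<in>C. x j - x i)"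
    by (subst sum.union_disjoint) (use fin inner in \<open>auto simp: B_def C_def\<close>)
  finally have flow: "(\<Sum>i\<in>U. real (card (hk_nbrs R E x i)) * y i) = (\<Sum>(i, j)\<in>C. x j - x i)" .
  have cross: "d / n \<le> x i - x j" if "(i, j) \<in> C" for i j
  proof -
    have "i \<in> {1..n}" "j \<in> {1..n}" "a < x i" "x j \<le> a"
      using that I(1)[of x] by (auto simp: C_def U_def)
    then show ?thesis
      using a(3)[of i] by auto
  qed
  have "d / n \<le> (\<Sum>(i, j)\<in>{(s, t)}. x i - x j)"
    using cross[of s t] st by (simp add: C_def)
  also have "\<dots> \<le> (\<Sum>(i, j)\<in>C. x i - x j)"
  proof (rule sum_mono2[OF fin(1)])
    show "{(s, t)} \<subseteq> C"
      using st by (simp add: C_def)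
    fix e assume "e \<in> C - {(s, t)}"
    then show "0 \<le> (case e of (i, j) \<Rightarrow> x i - x j)"
      using cross gap_pos by (fastforce split: prod.splits)
  qed
  also have "\<dots> = - (\<Sum>i\<in>U. real (card (hk_nbrs R E x i)) * y i)"
    unfolding flow by (simp add: case_prod_unfold flip: sum_negf)
  also have "\<dots> \<le> (\<Sum>i\<in>U. real n * \<bar>y i\<bar>)"
    unfolding sum_negf[symmetric]
  proof (rule sum_mono)
    fix i
    have "- (real (card (hk_nbrs R E x i)) * y i) \<le> real (card (hk_nbrs R E x i)) * \<bar>y i\<bar>"
      by (metis abs_ge_minus_self abs_mult abs_of_nat)
    also have "\<dots> \<le> real n * \<bar>y i\<bar>"
      using N(3) by (intro mult_right_mono) auto
    finally show "- (real (card (hk_nbrs R E x i)) * y i) \<le> real n * \<bar>y i\<bar>" .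
  qed
  also have "\<dots> \<le> (\<Sum>i\<in>{1..n}. real n * \<bar>y i\<bar>)"
    by (intro sum_mono2) (auto simp: U_def)
  finally have "d / n \<le> real n * (\<Sum>i\<in>{1..n}. \<bar>y i\<bar>)"
    by (simp add: sum_distrib_left)
  then have "d / (real n)\<^sup>2 \<le> (\<Sum>i\<in>{1..n}. \<bar>y i\<bar>)"
    using n by (simp add: field_simps power2_eq_square)
  then have "(d / (real n)\<^sup>2)\<^sup>2 \<le> (\<Sum>i\<in>{1..n}. \<bar>y i\<bar>)\<^sup>2"
    using assms(3) by (intro power_mono) auto
  also have "\<dots> \<le> real n * (\<Sum>i\<in>{1..n}. (y i)\<^sup>2)"
    using Cauchy_Schwarz_ineq_sum[of "\<lambda>_. 1" "\<lambda>i. \<bar>y i\<bar>" "{1..n}"] by simp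
  finally have "d\<^sup>2 / real n ^ 4 \<le> real n * (\<Sum>i\<in>{1..n}. (y i)\<^sup>2)"
    by (simp add: power_divide flip: power_mult)
  then have "d\<^sup>2 / real n ^ 5 \<le> (\<Sum>i\<in>{1..n}. (y i)\<^sup>2)"
    using n by (simp add: field_simps power_numeral_reduce)
  then show ?thesis
    by (simp add: y_def)
qed

text \<open>Both agents move to averages over agents of their common component, whose values are
  pairwise at most \<open>d\<close> apart.\<close>

lemma narrow_step:
  assumes "physical_graph n E" "R > 0" "d > 0"
    and narrow: "\<not> wide d (influence_edges R E x) x"
    and conn: "(i, j) \<in> (influence_edges R E x)\<^sup>*"
  shows "\<bar>hk_step n R E x i - hk_step n R E x j\<bar> \<le> d"
proof (cases "i = j")
  case True
  then show ?thesis
    using assms(3) by simp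
next
  case False
  let ?G = "influence_edges R E x"
  note I = influence_edges_basic[OF assms(1,2)]
  have V: "i \<in> {1..n}" "j \<in> {1..n}"
    using rtrancl_endpoints[OF conn I(1)] False by auto
  have close: "\<bar>x u - x v\<bar> \<le> d" if "(u, v) \<in> ?G\<^sup>*" for u v
    using narrow that by (fastforce simp: wide_def)
  have joined: "(u, v) \<in> ?G\<^sup>*" if "(i, u) \<in> ?G" "(j, v) \<in> ?G" for u v
    using that conn I(3)[of x]
    by (meson converse_rtrancl_into_rtrancl rtrancl.rtrancl_into_rtrancl symD)
  have half: "\<bar>hk_step n R E x i - x v\<bar> \<le> d" if "(j, v) \<in> ?G" for v
    using joined[OF _ that] close
    by (intro hk_step_near[OF assms(1,2) V(1)]) (simp add: hk_nbrs_def)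
  show ?thesis
    using half hk_step_near[OF assms(1,2) V(2), of x "hk_step n R E x i" d]
    by (auto simp: hk_nbrs_def abs_minus_commute)
qed

section \<open>Trajectories\<close>

lemma hk_traj_Suc: "hk_traj n R E x0 (Suc k) = hk_step n R E (hk_traj n R E x0 k)"
  by (simp add: hk_traj_def)

text \<open>Every wide time costs the energy at least \<open>4 d\<^sup>2 / n\<^sup>5\<close>.\<close>

lemma few_wide_times:
  fixes n R E x0
  assumes "physical_graph n E" "R > 0" "d > 0"
  defines "W \<equiv> {k. wide d (influence_graph n R E x0 k) (hk_traj n R E x0 k)}"
  shows "finite W" "real (card W) \<le> real n ^ 7 * R\<^sup>2 / (4 * d\<^sup>2)"
proof -
  let ?x = "hk_traj n R E x0"
  let ?c = "4 * (d\<^sup>2 / real n ^ 5)"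
  have n: "real n > 0"
    using physical_graphD(5)[OF assms(1)] by simp
  have c: "?c > 0"
    using n assms(3) by simp
  have step: "energy R E (?x (Suc k)) + (if k \<in> W then ?c else 0) \<le> energy R E (?x k)" for k
  proof -
    have "(if k \<in> W then ?c else 0) \<le> 4 * (\<Sum>i\<in>{1..n}. (hk_step n R E (?x k) i - ?x k i)\<^sup>2)"
      using wide_displacement[OF assms(1-3), of "?x k"]
      by (auto simp: W_def influence_graph_def intro!: sum_nonneg)
    then show ?thesis
      using energy_drop[OF assms(1,2), of "?x k"] by (simp add: hk_traj_Suc)
  qed
  have sum: "energy R E (?x m) + (\<Sum>k<m. if k \<in> W then ?c else 0) \<le> energy R E (?x 0)" for m
  proof (induction m)
    case (Suc m)
    then show ?case
      using step[of m] by simp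
  qed simp
  have bound: "card F \<le> nat \<lfloor>real n ^ 7 * R\<^sup>2 / (4 * d\<^sup>2)\<rfloor>" if F: "F \<subseteq> W" "finite F" for F
  proof -
    obtain m where m: "F \<subseteq> {..<m}"
      using finite_nat_bounded[OF F(2)] by blast
    have "real (card F) * ?c = (\<Sum>k\<in>F. if k \<in> W then ?c else 0)"
      using F(1) by (subst sum.cong[of F F _ "\<lambda>_. ?c"]) auto
    also have "\<dots> \<le> (\<Sum>k<m. if k \<in> W then ?c else 0)"
      using m c by (intro sum_mono2) auto
    also have "\<dots> \<le> (real n)\<^sup>2 * R\<^sup>2"
      using sum[of m] energy_nonneg[of R E "?x m"] energy_le[OF assms(1), of R "?x 0"] by linarith
    finally have "real (card F) \<le> (real n)\<^sup>2 * R\<^sup>2 / ?c"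
      using c by (simp only: pos_le_divide_eq)
    also have "\<dots> = real n ^ 7 * R\<^sup>2 / (4 * d\<^sup>2)"
      by (simp add: power_numeral_reduce)
    finally show ?thesis
      by (simp add: le_nat_floor)
  qed
  show "finite W"
    using bound finite_if_finite_subsets_card_bdd[of W] by blast
  then have "card W \<le> nat \<lfloor>real n ^ 7 * R\<^sup>2 / (4 * d\<^sup>2)\<rfloor>"
    using bound by blast
  then show "real (card W) \<le> real n ^ 7 * R\<^sup>2 / (4 * d\<^sup>2)"
    by (simp add: le_nat_iff le_floor_iff)
qed

lemma event_imp_wide:
  assumes "physical_graph n E" "R > 0" "Suc k \<in> event_times (influence_graph n R E x0)"
  shows "wide R (influence_graph n R E x0 k) (hk_traj n R E x0 k)"
proof (rule ccontr)
  let ?x = "hk_traj n R E x0" and ?G = "influence_graph n R E x0"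
  assume narrow: "\<not> wide R (?G k) (?x k)"
  consider i j where "(i, j) \<in> ?G k" "(i, j) \<notin> ?G (Suc k)"
    | i j where "(i, j) \<notin> ?G k" "(i, j) \<in> ?G (Suc k)" "(i, j) \<in> (?G k)\<^sup>*"
    using assms(3) by (auto simp: event_times_def link_break_at_def intra_component_formation_at_def)
  then show False
  proof cases
    case 1
    then have "R < \<bar>?x (Suc k) i - ?x (Suc k) j\<bar>"
      by (auto simp: influence_graph_def influence_edges_def)
    with narrow_step[OF assms(1,2,2), of "?x k" i j] narrow 1 show False
      by (auto simp: influence_graph_def hk_traj_Suc)
  next
    case 2
    then have "R < \<bar>?x k i - ?x k j\<bar>"
      by (auto simp: influence_graph_def influence_edges_def)
    with narrow 2 show False
      by (auto simp: wide_def)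
  qed
qed

lemma no_merging_components:
  assumes "physical_graph n E" "R > 0"
    and "\<not> merging_at {1..n} (influence_graph n R E x0) (Suc k)"
  shows "(influence_graph n R E x0 (Suc k))\<^sup>* \<subseteq> (influence_graph n R E x0 k)\<^sup>*"
proof (rule rtrancl_subset_rtrancl, rule subrelI, rule ccontr)
  let ?G = "influence_graph n R E x0"
  fix i j assume ij: "(i, j) \<in> ?G (Suc k)" "(i, j) \<notin> (?G k)\<^sup>*"
  have "i \<in> {1..n}" "j \<in> {1..n}"
    using ij(1) influence_edges_basic(1)[OF assms(1,2)] unfolding influence_graph_def by blast+
  then have "\<not> graph_connected {1..n} (?G k)"
    using ij(2) unfolding graph_connected_def by blast
  moreover have "\<exists>V1 V2. V1 \<subseteq> {1..n} \<and> V2 \<subseteq> {1..n} \<and>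
      (\<forall>u\<in>V1. \<forall>v\<in>V2. (u, v) \<notin> (?G k)\<^sup>*) \<and> (\<exists>i\<in>V1. \<exists>j\<in>V2. (i, j) \<in> ?G (Suc k))"
    by (rule exI[of _ "{i}"], rule exI[of _ "{j}"])
      (use ij \<open>i \<in> {1..n}\<close> \<open>j \<in> {1..n}\<close> in auto)
  ultimately have "merging_at {1..n} ?G (Suc k)"
    by (simp add: merging_at_def)
  then show False
    using assms(3) by blast
qed

lemma narrow_persists:
  assumes "physical_graph n E" "R > 0" "d > 0"
    and "\<not> merging_at {1..n} (influence_graph n R E x0) (Suc k)"
    and "\<not> wide d (influence_graph n R E x0 k) (hk_traj n R E x0 k)"
  shows "\<not> wide d (influence_graph n R E x0 (Suc k)) (hk_traj n R E x0 (Suc k))"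
proof -
  have "\<bar>hk_traj n R E x0 (Suc k) i - hk_traj n R E x0 (Suc k) j\<bar> \<le> d"
    if "(i, j) \<in> (influence_graph n R E x0 (Suc k))\<^sup>*" for i j
    using that no_merging_components[OF assms(1,2,4)] assms(5)
      narrow_step[OF assms(1-3), of "hk_traj n R E x0 k" i j]
    by (auto simp: influence_graph_def hk_traj_Suc)
  then show ?thesis
    by (fastforce simp: wide_def)
qed

text \<open>Narrowness persists, so a wide time forces all earlier times to be wide.\<close>

lemma wide_time_le:
  fixes n R E x0
  assumes "physical_graph n E" "R > 0" "d > 0"
    and nomerge: "\<And>m. m \<le> k \<Longrightarrow> \<not> merging_at {1..n} (influence_graph n R E x0) m"
    and wide: "wide d (influence_graph n R E x0 k) (hk_traj n R E x0 k)"
  shows "real (Suc k) \<le> real n ^ 7 * R\<^sup>2 / (4 * d\<^sup>2)"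
proof -
  let ?W = "{k. wide d (influence_graph n R E x0 k) (hk_traj n R E x0 k)}"
  have "m \<in> ?W" if "m \<le> k" for m
    using that
  proof (induction m rule: inc_induct)
    case base
    then show ?case
      using wide by simp
  next
    case (step m)
    then show ?case
      using narrow_persists[OF assms(1-3) nomerge[of "Suc m"]] by auto
  qed
  then have "card {..k} \<le> card ?W"
    using few_wide_times(1)[OF assms(1-3)] by (intro card_mono) auto
  then show ?thesis
    using few_wide_times(2)[OF assms(1-3), of x0] by simp
qed

section \<open>The number and the times of events\<close>

lemma events_occur_in_power7:
  assumes "physical_graph n E" "R > 0"
  shows "events_occur_in {1..n} (influence_graph n R E x0) (real n ^ 7)"
proof -
  let ?G = "influence_graph n R E x0"
  let ?W = "{k. wide R (?G k) (hk_traj n R E x0 k)}"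
  note W = few_wide_times[OF assms(1,2,2), of x0]
  have quarter: "real n ^ 7 * R\<^sup>2 / (4 * R\<^sup>2) \<le> real n ^ 7"
    using assms(2) by simp
  have event: "\<exists>m\<in>?W. k = Suc m" if "k \<in> event_times ?G" for k
  proof -
    have "k \<ge> 1"
      using that unfolding event_times_def link_break_at_def intra_component_formation_at_def by blast
    then obtain m where "k = Suc m"
      using not0_implies_Suc by fastforce
    then show ?thesis
      using event_imp_wide[OF assms, of m x0] that by blast
  qed
  then have sub: "event_times ?G \<subseteq> Suc ` ?W"
    by blast
  then have "card (event_times ?G) \<le> card ?W"
    using W(1) by (rule surj_card_le[rotated])
  then have "real (card (event_times ?G)) \<le> real n ^ 7"
    using W(2) quarter by linarith
  moreover have "real k \<le> real n ^ 7"
    if k: "k \<in> event_times ?G" and early: "\<forall>m<k. \<not> merging_at {1..n} ?G m" for k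
  proof -
    obtain m where m: "m \<in> ?W" "k = Suc m"
      using event[OF k] by blast
    then have "real (Suc m) \<le> real n ^ 7 * R\<^sup>2 / (4 * R\<^sup>2)"
      using early by (intro wide_time_le[OF assms assms(2), of m x0]) auto
    then show ?thesis
      using quarter m(2) by linarith
  qed
  moreover have "finite (event_times ?G)"
    using finite_subset[OF sub] W(1) by blast
  ultimately show ?thesis
    unfolding events_occur_in_def by blast
qed

section \<open>Convergence without merging\<close>

text \<open>Without merging, the agents that share a component at time \<open>k\<close> only average among
  themselves from then on, so they remain in every interval that contains them at time \<open>k\<close>.\<close>

lemma narrow_trapped:
  assumes "physical_graph n E" "R > 0" "d > 0"
    and nomerge: "\<And>m. \<not> merging_at {1..n} (influence_graph n R E x0) m"
    and narrow: "\<not> wide d (influence_graph n R E x0 k) (hk_traj n R E x0 k)"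
    and "i \<in> {1..n}" "k \<le> m"
  shows "\<bar>hk_traj n R E x0 m i - hk_traj n R E x0 k i\<bar> \<le> d"
proof -
  let ?x = "hk_traj n R E x0" and ?G = "influence_graph n R E x0"
  have comps: "(?G m)\<^sup>* \<subseteq> (?G k)\<^sup>*" if "k \<le> m" for m
    using that by (induction m rule: dec_induct)
      (use no_merging_components[OF assms(1,2) nomerge] in auto)
  have "\<forall>u\<in>{1..n}. (i, u) \<in> (?G k)\<^sup>* \<longrightarrow> \<bar>?x m u - ?x k i\<bar> \<le> d"
    using \<open>k \<le> m\<close>
  proof (induction m rule: dec_induct)
    case base
    then show ?case
      using narrow by (fastforce simp: wide_def abs_minus_commute)
  next
    case (step m)
    show ?case
    proof (intro ballI impI)
      fix u assume u: "u \<in> {1..n}" "(i, u) \<in> (?G k)\<^sup>*"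
      show "\<bar>?x (Suc m) u - ?x k i\<bar> \<le> d"
        unfolding hk_traj_Suc
      proof (rule hk_step_near[OF assms(1,2) u(1)])
        fix v assume v: "v \<in> hk_nbrs R E (?x m) u"
        then have "(u, v) \<in> (?G k)\<^sup>*"
          using comps[OF step(1)] by (auto simp: hk_nbrs_def influence_graph_def)
        moreover have "v \<in> {1..n}"
          using v hk_nbrs_basic(1)[OF assms(1,2)] by blast
        ultimately show "\<bar>?x m v - ?x k i\<bar> \<le> d"
          using step.IH u(2) by (meson rtrancl_trans)
      qed
    qed
  qed
  then show ?thesis
    using assms(6) by auto
qed

text \<open>The waiting time after which no component is wider than \<open>d\<close> is independent of the
  initial state, so the trajectories are Cauchy at a uniform rate. With all \<open>n\<close> coordinates
  within \<open>d\<close> of their limits the Euclidean error is at most \<open>n d\<close>; the factor \<open>2\<close> in \<open>d\<close> makes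
  this less than \<open>\<epsilon>\<close>.\<close>

lemma no_merging_conv_time:
  assumes "physical_graph n E" "R > 0" "\<epsilon> > 0"
    and nomerge: "\<And>m. \<not> merging_at {1..n} (influence_graph n R E x0) m"
  defines "d \<equiv> \<epsilon> / (2 * real n)"
  shows "conv_time n R E \<epsilon> x0 \<le> enat (nat \<lceil>real n ^ 7 * R\<^sup>2 / (4 * d\<^sup>2)\<rceil>)"
proof -
  let ?x = "hk_traj n R E x0" and ?G = "influence_graph n R E x0"
  define N where "N c = nat \<lceil>real n ^ 7 * R\<^sup>2 / (4 * c\<^sup>2)\<rceil>" for c :: real
  have n: "real n > 0"
    using physical_graphD(5)[OF assms(1)] by simp
  have trapped: "\<bar>?x m i - ?x k i\<bar> \<le> c" if "c > 0" "N c \<le> k" "k \<le> m" "i \<in> {1..n}" for c k m i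
  proof -
    have "\<not> wide c (?G k) (?x k)"
      using wide_time_le[OF assms(1,2) that(1) nomerge, of k] that(2) by (auto simp: N_def)
    then show ?thesis
      using narrow_trapped[OF assms(1,2) that(1) nomerge _ that(4,3)] by blast
  qed
  have conv: "(\<lambda>k. ?x k i) \<longlonglongrightarrow> steady_state n R E x0 i" if i: "i \<in> {1..n}" for i
  proof -
    have "Cauchy (\<lambda>k. ?x k i)"
    proof (rule metric_CauchyI)
      fix e :: real assume "e > 0"
      then have near: "\<bar>?x m i - ?x (N (e / 3)) i\<bar> \<le> e / 3" if "m \<ge> N (e / 3)" for m
        using trapped[of "e / 3" "N (e / 3)" m i] that i by simp
      have "dist (?x m i) (?x k i) < e" if "m \<ge> N (e / 3)" "k \<ge> N (e / 3)" for m k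
        using near[OF that(1)] near[OF that(2)] \<open>e > 0\<close> unfolding dist_real_def by linarith
      then show "\<exists>M. \<forall>m\<ge>M. \<forall>k\<ge>M. dist (?x m i) (?x k i) < e"
        by blast
    qed
    then show ?thesis
      using i by (simp add: steady_state_def real_Cauchy_convergent convergent_LIMSEQ_iff[symmetric])
  qed
  have d: "d > 0"
    using assms(3) n by (simp add: d_def)
  have "L2_set (\<lambda>i. ?x k i - steady_state n R E x0 i) {1..n} < \<epsilon>" if k: "k \<ge> N d" for k
  proof -
    have close: "\<bar>?x k i - steady_state n R E x0 i\<bar> \<le> d" if i: "i \<in> {1..n}" for i
    proof -
      have "(\<lambda>m. \<bar>?x m i - ?x k i\<bar>) \<longlonglongrightarrow> \<bar>steady_state n R E x0 i - ?x k i\<bar>"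
        by (intro tendsto_intros conv i)
      then have "\<bar>steady_state n R E x0 i - ?x k i\<bar> \<le> d"
        by (rule LIMSEQ_le_const2) (use trapped[OF d k _ i] in auto)
      then show ?thesis
        by (simp add: abs_minus_commute)
    qed
    have "L2_set (\<lambda>i. ?x k i - steady_state n R E x0 i) {1..n}
        \<le> (\<Sum>i\<in>{1..n}. \<bar>?x k i - steady_state n R E x0 i\<bar>)"
      by (rule L2_set_le_sum_abs)
    also have "\<dots> \<le> real n * d"
      using sum_bounded_above[of "{1..n}" "\<lambda>i. \<bar>?x k i - steady_state n R E x0 i\<bar>" d] close by simp
    also have "\<dots> < \<epsilon>"
      using n assms(3) by (simp add: d_def)
    finally show ?thesis .
  qed
  then have "conv_time n R E \<epsilon> x0 \<le> enat (N d)"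
    unfolding conv_time_def by (intro INF_lower) auto
  then show ?thesis
    by (simp add: N_def)
qed

theorem proposition4:
  fixes R :: real
  assumes "R > 0"
  shows
    "(\<exists>T :: nat \<Rightarrow> real. T \<in> O(\<lambda>n. real n ^ 8 * ln (real n)) \<and>
        (\<forall>n E x0. physical_graph n E \<longrightarrow> x0 \<in> state_space n \<longrightarrow>
           events_occur_in {1..n} (influence_graph n R E x0) (T n))) \<and>
     (\<forall>n E. physical_graph n E \<longrightarrow> (\<exists>\<epsilon>>0. max_conv_time n R E \<epsilon> = \<infinity>) \<longrightarrow>
        (\<exists>X0. X0 \<noteq> {} \<and> X0 \<subseteq> state_space n \<and>
           (\<forall>x0\<in>X0. \<exists>k. merging_at {1..n} (influence_graph n R E x0) k)))"
proof (intro conjI allI impI)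
  have "(\<lambda>n. real n ^ 7) \<in> O(\<lambda>n. real n ^ 8 * ln (real n))"
    by real_asymp
  then show "\<exists>T :: nat \<Rightarrow> real. T \<in> O(\<lambda>n. real n ^ 8 * ln (real n)) \<and>
        (\<forall>n E x0. physical_graph n E \<longrightarrow> x0 \<in> state_space n \<longrightarrow>
           events_occur_in {1..n} (influence_graph n R E x0) (T n))"
    using events_occur_in_power7[OF _ assms] by blast
next
  fix n E
  assume phys: "physical_graph n E" and "\<exists>\<epsilon>>0. max_conv_time n R E \<epsilon> = \<infinity>"
  then obtain \<epsilon> where \<epsilon>: "\<epsilon> > 0" "max_conv_time n R E \<epsilon> = \<infinity>"
    by blast
  have "\<exists>x0\<in>state_space n. \<exists>k. merging_at {1..n} (influence_graph n R E x0) k"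
  proof (rule ccontr)
    assume "\<not> ?thesis"
    then have "max_conv_time n R E \<epsilon>
        \<le> enat (nat \<lceil>real n ^ 7 * R\<^sup>2 / (4 * (\<epsilon> / (2 * real n))\<^sup>2)\<rceil>)"
      unfolding max_conv_time_def
      by (intro SUP_least no_merging_conv_time[OF phys assms \<epsilon>(1)]) blast
    then show False
      using \<epsilon>(2) by simp
  qed
  then obtain x0 where "x0 \<in> state_space n" "\<exists>k. merging_at {1..n} (influence_graph n R E x0) k"
    by blast
  then show "\<exists>X0. X0 \<noteq> {} \<and> X0 \<subseteq> state_space n \<and>
      (\<forall>x0\<in>X0. \<exists>k. merging_at {1..n} (influence_graph n R E x0) k)"
    by (intro exI[of _ "{x0}"]) simp
qed

end
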